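(* For each odd $n\ge 1$, the number of cycles of length $8$ in the regular locally transitive tournament $RLT_n$ is $$c_{8}(RLT_{n})=\frac{(n+1)n(n-1)(n-3)(n-5)(n-7)(83n^{2}-575n+510)}{161280}.$$
   Context: For odd $n$, $RLT_n$ is the tournament on vertex set $\mathbb{Z}_n=\{0,\dots,n-1\}$ in which $(i,j)$ is an arc if and only if $j-i \pmod n$ lies in $\{1,\dots,\frac{n-1}{2}\}$. (Equivalently, it is the unique regular tournament of order $n$ in which the out-set and in-set of every vertex induce transitive tournaments.) A cycle of length $m$ is a directed cycle through $m$ distinct vertices, counted as a subgraph (not with a distinguished starting point); $c_m(T)$ denotes the number of such cycles in $T$. *)

theory Defs
  imports Complex_Main "Graph_Theory.Graph_Theory"
begin

(* The tournament property (lemma RLT_tournament) holds only for odd n. *)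
definition RLT :: "nat \<Rightarrow> int pair_pre_digraph" where
  "RLT n = \<lparr> pverts = {0..<int n},
             parcs = {(i, j). i \<in> {0..<int n} \<and> j \<in> {0..<int n} \<and>
                        (j - i) mod int n \<in> {1..(int n - 1) div 2}} \<rparr>"

lemma pair_digraph_RLT: "pair_digraph (RLT n)"
proof unfold_locales
  have "parcs (RLT n) \<subseteq> {0..<int n} \<times> {0..<int n}"
    by (auto simp: RLT_def)
  then show "finite (parcs (RLT n))"
    by (rule finite_subset) simp
qed (auto simp: RLT_def)

lemma RLT_tournament:
  assumes "odd n" "i \<in> pverts (RLT n)" "j \<in> pverts (RLT n)" "i \<noteq> j"
  shows "(i, j) \<in> parcs (RLT n) \<longleftrightarrow> (j, i) \<notin> parcs (RLT n)"
proof -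
  obtain k where k: "int n = 2 * k + 1"
    using assms(1) by (metis even_of_nat_iff oddE)
  have ij: "0 \<le> i" "i < int n" "0 \<le> j" "j < int n"
    using assms(2,3) by (auto simp: RLT_def)
  have m: "(b - a) mod int n = b - a \<and> (a - b) mod int n = a - b + int n"
    if "a < b" "0 \<le> a" "b < int n" for a b :: int
    using that mod_pos_pos_trivial[of "a - b + int n" "int n"] by simp
  show ?thesis
    using m[of i j] m[of j i] ij k assms(4)
    by (cases "i < j") (auto simp: RLT_def)
qed

(* A cycle of the library is a list of arcs and so has a distinguished starting point.
   Taking the set of its arcs forgets that point; as a cycle is non-empty, this set also
   determines the vertices, so the cycles as subgraphs correspond to these arc sets. *)
definition num_cycles :: "('a, 'b) pre_digraph \<Rightarrow> nat \<Rightarrow> nat" where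
  "num_cycles G m = card {set p |p. pre_digraph.cycle G p \<and> length p = m}"

end

theory Submission
  imports Defs
begin

text \<open>
  Relabel the vertices by \<open>y \<mapsto> y / 2\<close> modulo \<open>n\<close>. Then for \<open>x < y\<close> there is an arc from \<open>x\<close> to \<open>y\<close>
  if \<open>x\<close> and \<open>y\<close> have the same parity, and from \<open>y\<close> to \<open>x\<close> otherwise. Hence the number of Hamiltonian
  cycles on vertices \<open>a\<^sub>1 < \<dots> < a\<^sub>8\<close> depends only on the parity pattern, and a pattern with \<open>e\<close> changes
  (after a virtual odd vertex in front) is realised by \<open>(n + e) div 2 choose 8\<close> such sequences.
  Summing the cycle counts of all 256 patterns, grouped by \<open>e\<close>, gives the polynomial.
\<close>

subsection \<open>Hamiltonian cycles of a parity pattern\<close>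

text \<open>
  A path under construction is stored as a zipper of parities (\<open>True\<close> for even): \<open>b\<close> is its last vertex,
  \<open>ls\<close> and \<open>rs\<close> are the unvisited vertices below (nearest first) and above it, and \<open>z\<close> is the starting
  vertex, smaller than all others. \<open>scan\<close> moves to each vertex of parity \<open>c\<close> on one side.
\<close>
primrec scan :: "(bool list \<Rightarrow> bool list \<Rightarrow> int) \<Rightarrow> bool \<Rightarrow> bool list \<Rightarrow> bool list \<Rightarrow> int" where
  "scan f c ps [] = 0"
| "scan f c ps (b # bs) = (if b = c then f ps bs else 0) + scan f c (b # ps) bs"

primrec ham_paths :: "nat \<Rightarrow> bool \<Rightarrow> bool list \<Rightarrow> bool \<Rightarrow> bool list \<Rightarrow> int" where
  "ham_paths 0 z ls b rs = (if b = z then 0 else 1)"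
| "ham_paths (Suc k) z ls b rs =
     scan (\<lambda>ls' rs'. ham_paths k z ls' b rs') b ls rs +
     scan (\<lambda>rs' ls'. ham_paths k z ls' (\<not> b) rs') (\<not> b) rs ls"

primrec ham_cycles :: "bool list \<Rightarrow> int" where
  "ham_cycles [] = 0"
| "ham_cycles (b # bs) = ham_paths (length bs) b [] b bs"

section \<open>Parity patterns with a given number of changes\<close>

primrec changes :: "bool \<Rightarrow> bool list \<Rightarrow> nat" where
  "changes p [] = 0"
| "changes p (b # bs) = (if b = p then 0 else 1) + changes b bs"

text \<open>The weight \<open>f\<close> is arbitrary so that recursion on the first entry can absorb
  that entry into it; the unfolding ends with \<open>f\<close> at explicit lists.\<close>

definition pattern_sum :: "nat \<Rightarrow> bool \<Rightarrow> nat \<Rightarrow> (bool list \<Rightarrow> int) \<Rightarrow> int" where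
  "pattern_sum k p e f = (\<Sum>bs | length bs = k \<and> changes p bs = e. f bs)"

lemma finite_patterns: "finite {bs :: bool list. length bs = k \<and> P bs}"
  by (rule finite_subset[OF _ finite_lists_length_eq[of "UNIV :: bool set" k]]) auto

lemma pattern_sum_0: "pattern_sum 0 p 0 f = f []" "pattern_sum 0 p (Suc e) f = 0"
proof -
  have "{bs. length bs = 0 \<and> changes p bs = 0} = {[]}" by auto
  then show "pattern_sum 0 p 0 f = f []" unfolding pattern_sum_def by simp
  have "{bs. length bs = 0 \<and> changes p bs = Suc e} = {}" by auto
  then show "pattern_sum 0 p (Suc e) f = 0" unfolding pattern_sum_def by (metis sum.empty)
qed

lemma pattern_sum_Suc_0: "pattern_sum (Suc k) p 0 f = pattern_sum k p 0 (\<lambda>bs. f (p # bs))"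
proof -
  have "{bs. length bs = Suc k \<and> changes p bs = 0} = (#) p ` {bs. length bs = k \<and> changes p bs = 0}"
    by (auto simp: length_Suc_conv split: if_splits)
  then show ?thesis unfolding pattern_sum_def by (simp add: sum.reindex)
qed

text \<open>The first entry either repeats \<open>p\<close> or uses up one change and becomes the
  new reference parity.\<close>

lemma pattern_sum_Suc_Suc:
  "pattern_sum (Suc k) p (Suc e) f =
     pattern_sum k p (Suc e) (\<lambda>bs. f (p # bs)) + pattern_sum k (\<not> p) e (\<lambda>bs. f ((\<not> p) # bs))"
proof -
  let ?A = "{bs. length bs = k \<and> changes p bs = Suc e}"
  let ?B = "{bs. length bs = k \<and> changes (\<not> p) bs = e}"
  have "{bs. length bs = Suc k \<and> changes p bs = Suc e} = (#) p ` ?A \<union> (#) (\<not> p) ` ?B"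
    by (auto simp: length_Suc_conv split: if_splits)
  moreover have "sum f ((#) p ` ?A \<union> (#) (\<not> p) ` ?B) = sum f ((#) p ` ?A) + sum f ((#) (\<not> p) ` ?B)"
    by (rule sum.union_disjoint) (auto simp: finite_patterns)
  ultimately show ?thesis unfolding pattern_sum_def by (simp add: sum.reindex)
qed

lemmas pattern_sum_rules = pattern_sum_0 pattern_sum_Suc_0
  pattern_sum_Suc_Suc[of _ True, simplified] pattern_sum_Suc_Suc[of _ False, simplified]

text \<open>
  First-order rules without \<open>if\<close>, so that \<open>simp only\<close> evaluates neither a branch that is not taken nor
  the functions passed to \<open>scan\<close> before they are applied.
\<close>
definition paths_right :: "nat \<Rightarrow> bool \<Rightarrow> bool list \<Rightarrow> bool \<Rightarrow> bool list \<Rightarrow> int" where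
  "paths_right k z ls b rs = scan (\<lambda>ls' rs'. ham_paths k z ls' b rs') b ls rs"

definition paths_left :: "nat \<Rightarrow> bool \<Rightarrow> bool list \<Rightarrow> bool \<Rightarrow> bool list \<Rightarrow> int" where
  "paths_left k z ls b rs = scan (\<lambda>rs' ls'. ham_paths k z ls' b rs') b rs ls"

lemma paths_rules:
  "paths_right k z ls b [] = 0"
  "paths_right k z ls True (True # rs) = ham_paths k z ls True rs + paths_right k z (True # ls) True rs"
  "paths_right k z ls True (False # rs) = paths_right k z (False # ls) True rs"
  "paths_right k z ls False (False # rs) = ham_paths k z ls False rs + paths_right k z (False # ls) False rs"
  "paths_right k z ls False (True # rs) = paths_right k z (True # ls) False rs"
  "paths_left k z [] b rs = 0"
  "paths_left k z (True # ls) True rs = ham_paths k z ls True rs + paths_left k z ls True (True # rs)"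
  "paths_left k z (False # ls) True rs = paths_left k z ls True (False # rs)"
  "paths_left k z (False # ls) False rs = ham_paths k z ls False rs + paths_left k z ls False (False # rs)"
  "paths_left k z (True # ls) False rs = paths_left k z ls False (True # rs)"
  "ham_paths 0 True ls True rs = 0"
  "ham_paths 0 False ls False rs = 0"
  "ham_paths 0 True ls False rs = 1"
  "ham_paths 0 False ls True rs = 1"
  "ham_paths (Suc k) z ls True rs = paths_right k z ls True rs + paths_left k z ls False rs"
  "ham_paths (Suc k) z ls False rs = paths_right k z ls False rs + paths_left k z ls True rs"
  by (simp_all add: paths_right_def paths_left_def)

lemmas ham_cycles_rules = ham_cycles.simps list.size paths_rules
  add_0 add_0_right add_Suc_right arith_simps one_add_one add_numeral_special

text \<open>At most one change leaves at most two blocks of equal parity, and all arcs between them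
  lead from the upper to the lower block, so there is no cycle. The other values come from
  evaluating every pattern.\<close>

lemma pattern_sum_8:
  "pattern_sum 8 False 0 ham_cycles = 0"
  "pattern_sum 8 False 1 ham_cycles = 0"
  "pattern_sum 8 False 2 ham_cycles = 213"
  "pattern_sum 8 False 3 ham_cycles = 568"
  "pattern_sum 8 False 4 ham_cycles = 1415"
  "pattern_sum 8 False 5 ham_cycles = 1696"
  "pattern_sum 8 False 6 ham_cycles = 979"
  "pattern_sum 8 False 7 ham_cycles = 392"
  "pattern_sum 8 False 8 ham_cycles = 49"
  \<comment> \<open>The first pass expands each sum into \<open>ham_cycles\<close> at explicit
    lists, the second runs the path search on them.\<close>
  by (simp_all only: numeral_nat One_nat_def pattern_sum_rules, simp_all only: ham_cycles_rules)

subsection \<open>Cycles of the parity tournament\<close>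

text \<open>The relabelled tournament; for \<open>x = y\<close> the right-hand side is false, so
  there are no loops.\<close>

definition arc :: "nat \<Rightarrow> nat \<Rightarrow> bool" where
  "arc x y \<longleftrightarrow> (x < y \<longleftrightarrow> (even x \<longleftrightarrow> even y))"

text \<open>Only interior vertices are listed, so \<open>x = z\<close> is allowed: for
  \<open>x\<close> outside \<open>A\<close>, \<open>paths E x A x\<close> encodes the Hamiltonian
  cycles on \<open>insert x A\<close>, read from \<open>x\<close>.\<close>

definition paths :: "('a \<Rightarrow> 'a \<Rightarrow> bool) \<Rightarrow> 'a \<Rightarrow> 'a set \<Rightarrow> 'a \<Rightarrow> 'a list set" where
  "paths E x A z = {ys. distinct ys \<and> set ys = A \<and> successively E (x # ys @ [z])}"

lemma finite_paths: "finite A \<Longrightarrow> finite (paths E x A z)"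
  by (rule finite_subset[OF _ finite_subset_distinct[of A]]) (auto simp: paths_def)

lemma card_paths_empty: "card (paths E x {} z) = (if E x z then 1 else 0)"
proof -
  have "paths E x {} z = (if E x z then {[]} else {})" by (auto simp: paths_def)
  then show ?thesis by simp
qed

lemma card_paths_rec:
  assumes "finite A" "A \<noteq> {}"
  shows "card (paths E x A z) = (\<Sum>y\<in>A. if E x y then card (paths E y (A - {y}) z) else 0)"
proof -
  have "paths E x A z = (\<Union>y\<in>{y\<in>A. E x y}. (#) y ` paths E y (A - {y}) z)" (is "?L = ?R")
  proof (intro equalityI subsetI)
    fix ys assume ys: "ys \<in> ?L"
    then obtain y ys' where "ys = y # ys'"
      using assms(2) by (cases ys) (auto simp: paths_def)
    moreover from this ys have "y \<in> A" "E x y" "ys' \<in> paths E y (A - {y}) z"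
      by (auto simp: paths_def)
    ultimately show "ys \<in> ?R" by blast
  next
    fix ys assume "ys \<in> ?R"
    then obtain y ys' where "y \<in> A" "E x y" "ys' \<in> paths E y (A - {y}) z" "ys = y # ys'"
      by blast
    then show "ys \<in> ?L" unfolding paths_def by simp blast
  qed
  also have "card \<dots> = (\<Sum>y\<in>{y\<in>A. E x y}. card ((#) y ` paths E y (A - {y}) z))"
    using assms(1) by (intro card_UN_disjoint) (auto intro: finite_paths)
  also have "\<dots> = (\<Sum>y\<in>{y\<in>A. E x y}. card (paths E y (A - {y}) z))"
    by (simp add: card_image)
  also have "\<dots> = (\<Sum>y\<in>A. if E x y then card (paths E y (A - {y}) z) else 0)"
    using assms(1) by (rule sum.inter_filter)
  finally show ?thesis .
qed

text \<open>Scanning leaves \<open>rev ps @ bs\<close> invariant, so \<open>f\<close> has to be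
  known only at splits of this one list.\<close>

lemma scan_eq_sum:
  assumes "distinct bs"
    and "\<And>ps' y bs'. rev ps @ bs = rev ps' @ y # bs' \<Longrightarrow> y \<in> set bs \<Longrightarrow> even y = c \<Longrightarrow>
           f (map even ps') (map even bs') = g y"
  shows "scan f c (map even ps) (map even bs) = (\<Sum>y\<in>set bs. if even y = c then g y else 0)"
  using assms
proof (induction bs arbitrary: ps)
  case (Cons b bs)
  have "scan f c (map even (b # ps)) (map even bs) = (\<Sum>y\<in>set bs. if even y = c then g y else 0)"
    using Cons.prems by (intro Cons.IH) auto
  moreover have "f (map even ps) (map even bs) = g b" if "even b = c"
    using that by (intro Cons.prems(2)) auto
  ultimately show ?case using Cons.prems(1) by simp
qed simp

text \<open>Arcs up need equal parity and arcs down opposite parity, so the two scans visit exactly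
  the unvisited out-neighbours of \<open>x\<close>. The weak bound \<open>z \<le> x\<close> admits
  the start of the search, where \<open>x = z\<close>.\<close>

lemma ham_paths_eq_card:
  assumes "sorted_wrt (<) (rev ls @ x # rs)" "z \<le> x" "\<forall>l\<in>set ls. z < l"
    and "length ls + length rs = k"
  shows "ham_paths k (even z) (map even ls) (even x) (map even rs) =
           int (card (paths arc x (set ls \<union> set rs) z))"
  using assms
proof (induction k arbitrary: ls x rs)
  case 0
  then show ?case by (auto simp: card_paths_empty arc_def)
next
  case (Suc k)
  have sorted: "sorted_wrt (<) (rev ls @ rs)" "\<forall>l\<in>set ls. l < x" "\<forall>r\<in>set rs. x < r"
    and dist: "distinct ls" "distinct rs" "set ls \<inter> set rs = {}"
    using Suc.prems(1) strict_sorted_iff[of "rev ls @ x # rs"] by (auto simp: sorted_wrt_append)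
  define A where "A = set ls \<union> set rs"
  define g where "g y = int (card (paths arc y (A - {y}) z))" for y
  \<comment> \<open>A step to \<open>y\<close> gives a zipper around \<open>y\<close> for the
    remaining vertices.\<close>
  have *: "ham_paths k (even z) (map even ls') (even y) (map even rs') = g y"
    if split: "rev ls @ rs = rev ls' @ y # rs'" for ls' y rs'
  proof -
    have "A = set (rev ls @ rs)" by (simp add: A_def)
    then have A: "A = insert y (set ls' \<union> set rs')"
      unfolding split by auto
    have "\<forall>a\<in>A. z < a" using Suc.prems(2,3) sorted by (auto simp: A_def)
    moreover have "y \<notin> set ls' \<union> set rs'"
      using sorted(1) unfolding split by (auto simp: sorted_wrt_append)
    moreover have "length ls' + length rs' = k"
      using arg_cong[OF split, of length] Suc.prems(4) by simp
    ultimately show ?thesis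
      using Suc.IH[of ls' y rs'] sorted(1) A unfolding split by (simp add: g_def less_imp_le)
  qed
  have R: "scan (\<lambda>ls' rs'. ham_paths k (even z) ls' (even x) rs') (even x) (map even ls) (map even rs)
      = (\<Sum>y\<in>set rs. if even y = even x then g y else 0)"
  proof (intro scan_eq_sum)
    fix ps' y bs' assume "rev ls @ rs = rev ps' @ y # bs'" "even y = even x"
    then show "ham_paths k (even z) (map even ps') (even x) (map even bs') = g y"
      using *[of ps' y bs'] by simp
  qed (use dist in simp)
  have L: "scan (\<lambda>rs' ls'. ham_paths k (even z) ls' (\<not> even x) rs') (\<not> even x) (map even rs) (map even ls)
      = (\<Sum>y\<in>set ls. if even y = (\<not> even x) then g y else 0)"
  proof (intro scan_eq_sum)
    fix ps' y bs' assume "rev rs @ ls = rev ps' @ y # bs'" "even y = (\<not> even x)"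
    \<comment> \<open>Reversal turns a split met by the leftward scan into one of
      \<open>rev ls @ rs\<close>, with the sides interchanged.\<close>
    from arg_cong[OF this(1), of rev] this(2)
    show "ham_paths k (even z) (map even bs') (\<not> even x) (map even ps') = g y"
      using *[of bs' y ps'] by simp
  qed (use dist in simp)
  have "int (card (paths arc x A z)) = (\<Sum>y\<in>A. if arc x y then g y else 0)"
    using Suc.prems(4) by (subst card_paths_rec) (auto simp: A_def g_def of_nat_sum intro!: sum.cong)
  also have "\<dots> = (\<Sum>y\<in>set ls. if arc x y then g y else 0) + (\<Sum>y\<in>set rs. if arc x y then g y else 0)"
    unfolding A_def using dist by (intro sum.union_disjoint) auto
  also have "(\<Sum>y\<in>set ls. if arc x y then g y else 0) = (\<Sum>y\<in>set ls. if even y = (\<not> even x) then g y else 0)"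
    using sorted by (intro sum.cong) (auto simp: arc_def)
  also have "(\<Sum>y\<in>set rs. if arc x y then g y else 0) = (\<Sum>y\<in>set rs. if even y = even x then g y else 0)"
    using sorted by (intro sum.cong) (auto simp: arc_def)
  finally show ?case by (simp add: R L A_def)
qed

lemma ham_cycles_eq_card:
  assumes "sorted_wrt (<) (z # rs)"
  shows "ham_cycles (map even (z # rs)) = int (card (paths arc z (set rs) z))"
  using ham_paths_eq_card[of "[]" z rs z "length rs"] assms by simp

section \<open>Increasing sequences with a given parity pattern\<close>

lemma changes_append: "changes p (bs @ [b]) = changes p bs + (if last (p # bs) = b then 0 else 1)"
  by (induction bs arbitrary: p) auto

lemma odd_changes_iff: "odd (changes p bs) \<longleftrightarrow> last (p # bs) \<noteq> p"
  by (induction bs arbitrary: p) auto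

lemma changes_le_length: "changes p bs \<le> length bs"
  by (induction bs arbitrary: p) (auto intro: le_SucI)

definition increasing_lists :: "nat \<Rightarrow> nat \<Rightarrow> nat list set" where
  "increasing_lists n k = {xs. sorted_wrt (<) xs \<and> set xs \<subseteq> {..<n} \<and> length xs = k}"

lemma finite_increasing_lists: "finite (increasing_lists n k)"
  by (rule finite_subset[OF _ finite_lists_length_eq[of "{..<n}" k]]) (auto simp: increasing_lists_def)

text \<open>
  A list with a prescribed parity pattern has a least possible last entry; the slack is distributed in
  steps of 2. The initial \<open>False\<close> is the parity of a virtual entry \<open>-1\<close>.
\<close>
lemma card_increasing_lists_pattern:
  "card {xs \<in> increasing_lists n (length bs). map even xs = bs} =
     ((n + changes False bs) div 2) choose length bs"
proof (induction bs arbitrary: n rule: rev_induct)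
  case Nil
  have "{xs \<in> increasing_lists n (length []). map even xs = []} = {[]}"
    by (auto simp: increasing_lists_def)
  then show ?case by simp
next
  case (snoc b bs)
  define I where "I n bs = {xs \<in> increasing_lists n (length bs). map even xs = bs}" for n bs
  have fin: "finite (I n bs)" for n bs by (auto simp: I_def finite_increasing_lists)
  let ?e = "changes False bs" let ?e' = "changes False (bs @ [b])"
  \<comment> \<open>Each change flips the parity, starting from odd, so the last entry is even
    exactly if \<open>?e'\<close> is odd.\<close>
  have e': "odd ?e' \<longleftrightarrow> b" "?e' = ?e + (if last (False # bs) = b then 0 else 1)"
    by (simp only: odd_changes_iff, simp) (simp only: changes_append)
  have "card (I n (bs @ [b])) = ((n + ?e') div 2) choose Suc (length bs)"
  proof (induction n)
    case 0
    have "?e' \<le> Suc (length bs)" using changes_le_length[of False "bs @ [b]"] by simp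
    then have "?e' div 2 < Suc (length bs)" by simp
    moreover have "I 0 (bs @ [b]) = {}" by (auto simp: I_def increasing_lists_def)
    ultimately show ?case by simp
  next
    case (Suc n)
    \<comment> \<open>The new value \<open>n\<close> is either absent or the last entry, and then
      its parity must be \<open>b\<close>.\<close>
    have "I (Suc n) (bs @ [b]) = I n (bs @ [b]) \<union> (if even n = b then (\<lambda>xs. xs @ [n]) ` I n bs else {})"
      (is "?L = ?R")
    proof (intro equalityI subsetI)
      fix xs assume "xs \<in> ?L"
      then obtain ys y where xs: "xs = ys @ [y]" "length ys = length bs"
        by (cases xs rule: rev_cases) (auto simp: I_def increasing_lists_def)
      then show "xs \<in> ?R" using \<open>xs \<in> ?L\<close>
        by (cases "y = n") (fastforce simp: I_def increasing_lists_def sorted_wrt_append)+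
    next
      fix xs assume "xs \<in> ?R"
      then show "xs \<in> ?L"
        by (fastforce simp: I_def increasing_lists_def sorted_wrt_append split: if_splits)
    qed
    also have "card \<dots> = card (I n (bs @ [b])) + (if even n = b then card (I n bs) else 0)"
      by (subst card_Un_disjoint)
        (auto simp: fin card_image inj_on_def, auto simp: I_def increasing_lists_def)
    \<comment> \<open>If \<open>n\<close> has parity \<open>b\<close>, then \<open>n + ?e'\<close>
      is odd, the half grows by one and Pascal's rule applies. Otherwise \<open>n + ?e'\<close> is
      even and the half stays the same.\<close>
    also have "\<dots> = ((Suc n + ?e') div 2) choose Suc (length bs)"
    proof (cases "even n = b")
      case True
      then have "odd (n + ?e')" using e'(1) by auto
      then obtain q where q: "n + ?e' = 2 * q + 1" by (rule oddE)
      then have "(n + ?e) div 2 = q" using e'(2) by (auto split: if_splits)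
      then show ?thesis using True Suc q snoc.IH[of n] by (simp add: I_def)
    next
      case False
      then have "even (n + ?e')" using e'(1) by auto
      then show ?thesis using False Suc by simp
    qed
    finally show ?case .
  qed
  then show ?case by (simp add: I_def)
qed

section \<open>Cycles rooted at their smallest vertex\<close>

definition rooted_cycles :: "nat \<Rightarrow> nat \<Rightarrow> nat list set" where
  "rooted_cycles n k = {z # ys | z ys. length ys = k \<and> distinct ys \<and> set (z # ys) \<subseteq> {..<n} \<and>
     (\<forall>y\<in>set ys. z < y) \<and> successively arc (z # ys @ [z])}"

text \<open>A rooted cycle with \<open>k\<close> vertices besides its root amounts to the sorted
  list \<open>xs\<close> of its vertices and an arrangement of \<open>tl xs\<close> as a path from
  \<open>hd xs\<close> back to itself.\<close>

lemma card_rooted_cycles_eq_sum: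
  "int (card (rooted_cycles n k)) = (\<Sum>xs\<in>increasing_lists n (Suc k). ham_cycles (map even xs))"
proof -
  let ?P = "\<lambda>xs. paths arc (hd xs) (set (tl xs)) (hd xs)"
  have "bij_betw (\<lambda>(xs, ys). hd xs # ys) (SIGMA xs:increasing_lists n (Suc k). ?P xs) (rooted_cycles n k)"
    unfolding bij_betw_def
  proof
    show "inj_on (\<lambda>(xs, ys). hd xs # ys) (SIGMA xs:increasing_lists n (Suc k). ?P xs)"
    proof (rule inj_onI)
      fix p q assume pq: "p \<in> (SIGMA xs:increasing_lists n (Suc k). ?P xs)"
        "q \<in> (SIGMA xs:increasing_lists n (Suc k). ?P xs)"
        "(\<lambda>(xs, ys). hd xs # ys) p = (\<lambda>(xs, ys). hd xs # ys) q"
      obtain xs ys xs' ys' where p: "p = (xs, ys)" "q = (xs', ys')" by fastforce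
      have *: "xs \<in> increasing_lists n (Suc k)" "xs' \<in> increasing_lists n (Suc k)"
        "ys \<in> ?P xs" "ys' \<in> ?P xs'" and eq: "hd xs # ys = hd xs' # ys'"
        using pq unfolding p by auto
      have "set us = insert (hd us) (set vs)" if "us \<in> increasing_lists n (Suc k)" "vs \<in> ?P us" for us vs
        using that by (cases us) (auto simp: paths_def increasing_lists_def)
      then have "set xs = set xs'" using * eq by auto
      then show "p = q"
        unfolding p using * eq by (auto simp: increasing_lists_def intro: strict_sorted_equal)
    qed
    show "(\<lambda>(xs, ys). hd xs # ys) ` (SIGMA xs:increasing_lists n (Suc k). ?P xs) = rooted_cycles n k"
      (is "?L = ?R")
    proof (intro equalityI subsetI)
      fix v assume "v \<in> ?L"
      then obtain xs ys where v: "v = hd xs # ys" "xs \<in> increasing_lists n (Suc k)" "ys \<in> ?P xs"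
        by auto
      obtain z zs where xs: "xs = z # zs"
        using v(2) by (cases xs) (auto simp: increasing_lists_def)
      have "length ys = length zs"
        using v xs by (auto simp: increasing_lists_def paths_def strict_sorted_iff dest!: distinct_card)
      then show "v \<in> ?R" using v xs
        by (auto simp: increasing_lists_def paths_def rooted_cycles_def)
    next
      fix v assume "v \<in> ?R"
      then obtain z ys where v: "v = z # ys" "length ys = k" "distinct ys" "set (z # ys) \<subseteq> {..<n}"
        "\<forall>y\<in>set ys. z < y" "successively arc (z # ys @ [z])"
        by (auto simp: rooted_cycles_def)
      have "z # sort ys \<in> increasing_lists n (Suc k)"
        using v by (auto simp: increasing_lists_def strict_sorted_iff)
      moreover have "ys \<in> ?P (z # sort ys)"
        using v by (simp add: paths_def)
      ultimately show "v \<in> ?L" using v(1) by force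
    qed
  qed
  then have "card (rooted_cycles n k) = card (SIGMA xs:increasing_lists n (Suc k). ?P xs)"
    by (simp add: bij_betw_same_card)
  also have "\<dots> = (\<Sum>xs\<in>increasing_lists n (Suc k). card (?P xs))"
    by (rule card_SigmaI) (auto simp: finite_increasing_lists finite_paths)
  finally have "int (card (rooted_cycles n k)) = (\<Sum>xs\<in>increasing_lists n (Suc k). int (card (?P xs)))"
    by simp
  also have "\<dots> = (\<Sum>xs\<in>increasing_lists n (Suc k). ham_cycles (map even xs))"
  proof (rule sum.cong)
    fix xs assume "xs \<in> increasing_lists n (Suc k)"
    then show "int (card (?P xs)) = ham_cycles (map even xs)"
      using ham_cycles_eq_card[of "hd xs" "tl xs"] by (cases xs) (auto simp: increasing_lists_def)
  qed simp
  finally show ?thesis .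
qed

text \<open>Group by pattern and then by number of changes, which alone determines how many
  sequences realise a pattern.\<close>

lemma card_rooted_cycles:
  "int (card (rooted_cycles n k)) =
     (\<Sum>e\<le>Suc k. pattern_sum (Suc k) False e ham_cycles * int ((n + e) div 2 choose Suc k))"
proof -
  let ?B = "{bs :: bool list. length bs = Suc k}"
  have finB: "finite ?B" using finite_patterns[of "Suc k" "\<lambda>_. True"] by simp
  have "(\<Sum>xs\<in>increasing_lists n (Suc k). ham_cycles (map even xs)) =
      (\<Sum>bs\<in>?B. \<Sum>xs | xs \<in> increasing_lists n (Suc k) \<and> map even xs = bs. ham_cycles (map even xs))"
    by (rule sum.group[symmetric]) (auto simp: finB finite_increasing_lists, auto simp: increasing_lists_def)
  also have "\<dots> = (\<Sum>bs\<in>?B. ham_cycles bs * int ((n + changes False bs) div 2 choose Suc k))"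
  proof (rule sum.cong)
    fix bs :: "bool list" assume "bs \<in> ?B"
    then show "(\<Sum>xs | xs \<in> increasing_lists n (Suc k) \<and> map even xs = bs. ham_cycles (map even xs)) =
        ham_cycles bs * int ((n + changes False bs) div 2 choose Suc k)"
      using card_increasing_lists_pattern[of n bs] by simp
  qed simp
  also have "\<dots> = (\<Sum>e\<le>Suc k. \<Sum>bs | bs \<in> ?B \<and> changes False bs = e.
      ham_cycles bs * int ((n + changes False bs) div 2 choose Suc k))"
    by (rule sum.group[symmetric]) (auto simp: finB, metis changes_le_length)
  also have "\<dots> = (\<Sum>e\<le>Suc k. pattern_sum (Suc k) False e ham_cycles * int ((n + e) div 2 choose Suc k))"
    unfolding pattern_sum_def by (auto simp: sum_distrib_right intro!: sum.cong)
  finally show ?thesis by (simp add: card_rooted_cycles_eq_sum)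
qed

subsection \<open>Cycles of the locally transitive tournament\<close>

definition cycle_arcs :: "'a list \<Rightarrow> ('a \<times> 'a) set" where
  "cycle_arcs vs = set (zip vs (rotate1 vs))"

lemma cycle_arcs_Cons_subset_iff:
  "cycle_arcs (x # xs) \<subseteq> A \<longleftrightarrow> successively (\<lambda>a b. (a, b) \<in> A) (x # xs @ [x])"
proof -
  \<comment> \<open>The first vertex is generalised to \<open>y\<close> for the induction while the
    closing vertex \<open>x\<close> stays fixed.\<close>
  have "set (zip (y # xs) (xs @ [x])) \<subseteq> A \<longleftrightarrow> successively (\<lambda>a b. (a, b) \<in> A) (y # xs @ [x])" for y
    by (induction xs arbitrary: y) auto
  then show ?thesis by (simp add: cycle_arcs_def)
qed

lemma cycle_arcs_rotate: "cycle_arcs (rotate k vs) = cycle_arcs vs"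
proof -
  have "cycle_arcs (rotate1 vs) = cycle_arcs vs" for vs :: "'a list"
  proof (cases vs)
    case (Cons x xs)
    show ?thesis
    proof (cases xs)
      case (Cons y ys)
      have "zip ((y # ys) @ [x]) ((ys @ [x]) @ [y]) = zip (y # ys) (ys @ [x]) @ [(x, y)]"
        by (subst zip_append) simp_all
      then show ?thesis by (simp add: \<open>vs = x # xs\<close> Cons cycle_arcs_def)
    qed (simp add: Cons)
  qed simp
  then show ?thesis by (induction k) auto
qed

lemma cycle_arcs_map: "cycle_arcs (map f vs) = map_prod f f ` cycle_arcs vs"
  by (simp add: cycle_arcs_def rotate1_map zip_map_map map_prod_def)

lemma Domain_cycle_arcs: "Domain (cycle_arcs vs) = set vs"
  by (simp add: cycle_arcs_def Domain_fst flip: set_map)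

lemma cycle_arcs_subset: "cycle_arcs vs \<subseteq> set vs \<times> set vs"
  unfolding cycle_arcs_def by (metis set_rotate1 set_zip_leftD set_zip_rightD subrelI SigmaI)

text \<open>In the arc set of a distinct list each vertex has exactly one successor, so a common
  head fixes all further entries.\<close>

lemma cycle_arcs_inject:
  assumes "distinct vs" "distinct ws" "cycle_arcs vs = cycle_arcs ws" "hd vs = hd ws"
  shows "vs = ws"
proof -
  have "set vs = set ws" using assms(3) by (metis Domain_cycle_arcs)
  then have len: "length vs = length ws" using assms(1,2) by (metis distinct_card)
  have "vs ! i = ws ! i" if "i < length vs" for i
    using that
  proof (induction i)
    case 0
    then show ?case using assms(4) len by (metis hd_conv_nth length_greater_0_conv)
  next
    case (Suc i)
    have "(vs ! i, vs ! Suc i) \<in> cycle_arcs vs"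
      using Suc.prems unfolding cycle_arcs_def in_set_conv_nth
      by (intro exI[of _ i]) (simp add: nth_rotate1)
    then have "(vs ! i, vs ! Suc i) \<in> cycle_arcs ws" by (simp only: assms(3))
    then obtain j where j: "j < length ws" "vs ! i = ws ! j" "vs ! Suc i = ws ! (Suc j mod length ws)"
      by (auto simp: cycle_arcs_def in_set_conv_nth nth_rotate1)
    have "j = i" using j Suc len assms(2) by (simp add: nth_eq_iff_index_eq)
    then show ?case using j(3) Suc.prems len by simp
  qed
  then show ?thesis using len by (simp add: nth_equalityI)
qed

lemma cas_with_proj_iff:
  "pre_digraph.cas (with_proj G) u p v \<longleftrightarrow> map fst p @ [v] = u # map snd p"
  by (induction p arbitrary: u) (auto simp: pre_digraph.cas.simps)

lemma awalk_verts_with_proj: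
  "tl (pre_digraph.awalk_verts (with_proj G) u p) = map snd p" if "pre_digraph.cas (with_proj G) u p v"
proof -
  have "pre_digraph.awalk_verts (with_proj G) u p = u # map snd p"
    using that by (induction p arbitrary: u) (auto simp: pre_digraph.cas.simps pre_digraph.awalk_verts.simps)
  then show ?thesis by simp
qed

text \<open>In a closed walk the heads of the arcs are their tails rotated by one. Hence the tails
  determine the walk, and they are distinct exactly if the heads are.\<close>

lemma cycle_with_proj_iff:
  assumes "pair_wf_digraph G"
  shows "pre_digraph.cycle (with_proj G) p \<longleftrightarrow>
    (\<exists>vs. vs \<noteq> [] \<and> distinct vs \<and> p = zip vs (rotate1 vs) \<and> cycle_arcs vs \<subseteq> parcs G)"
proof
  assume "pre_digraph.cycle (with_proj G) p"
  then obtain u where u: "pre_digraph.awalk (with_proj G) u p u"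
    "distinct (tl (pre_digraph.awalk_verts (with_proj G) u p))" "p \<noteq> []"
    by (auto simp: pre_digraph.cycle_def)
  then have cas: "pre_digraph.cas (with_proj G) u p u" "set p \<subseteq> parcs G"
    by (auto simp: pre_digraph.awalk_def)
  have "distinct (map snd p)" using u(2) awalk_verts_with_proj[OF cas(1)] by simp
  have eq: "map fst p @ [u] = u # map snd p" using cas by (simp add: cas_with_proj_iff)
  obtain e es where p: "p = e # es" using u(3) by (cases p) auto
  have rot: "rotate1 (map fst p) = map snd p" using eq by (simp add: p)
  then have "p = zip (map fst p) (rotate1 (map fst p))" by (simp add: zip_map_fst_snd)
  moreover have "distinct (map fst p)"
    using rot \<open>distinct (map snd p)\<close> by (metis distinct1_rotate)
  ultimately show "\<exists>vs. vs \<noteq> [] \<and> distinct vs \<and> p = zip vs (rotate1 vs) \<and> cycle_arcs vs \<subseteq> parcs G"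
    using u(3) cas(2) unfolding cycle_arcs_def by (metis map_is_Nil_conv)
next
  assume "\<exists>vs. vs \<noteq> [] \<and> distinct vs \<and> p = zip vs (rotate1 vs) \<and> cycle_arcs vs \<subseteq> parcs G"
  then obtain v vs where vs: "distinct (v # vs)" "p = zip (v # vs) (vs @ [v])" "set p \<subseteq> parcs G"
    unfolding cycle_arcs_def by (metis list.exhaust rotate1.simps(2))
  have "p \<noteq> []" "fst (hd p) = v" unfolding vs by (cases vs; simp)+
  then have "v \<in> pverts G"
    using vs(3) pair_wf_digraph.in_arcsD1[OF assms] by (metis hd_in_set prod.collapse subsetD)
  moreover have maps: "map fst p = v # vs" "map snd p = vs @ [v]"
    unfolding vs by simp_all
  then have cas: "pre_digraph.cas (with_proj G) v p v" by (simp add: cas_with_proj_iff)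
  ultimately show "pre_digraph.cycle (with_proj G) p"
    using vs(1,3) \<open>p \<noteq> []\<close> awalk_verts_with_proj[OF cas] maps
    by (auto simp: pre_digraph.cycle_def pre_digraph.awalk_def)
qed

text \<open>The bound \<open>m > 0\<close> excludes the empty vertex list, whose empty arc set does
  not come from a cycle.\<close>

lemma num_cycles_with_proj:
  assumes "pair_wf_digraph G" "m > 0"
  shows "num_cycles (with_proj G) m =
    card {cycle_arcs vs | vs. length vs = m \<and> distinct vs \<and> cycle_arcs vs \<subseteq> parcs G}"
proof -
  have "{set p |p. pre_digraph.cycle (with_proj G) p \<and> length p = m} =
    {cycle_arcs vs | vs. length vs = m \<and> distinct vs \<and> cycle_arcs vs \<subseteq> parcs G}"
    unfolding cycle_with_proj_iff[OF assms(1)] using assms(2)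
    by (fastforce simp: cycle_arcs_def)
  then show ?thesis by (simp add: num_cycles_def)
qed

section \<open>The relabelling isomorphism\<close>

text \<open>Division by 2 modulo the odd number \<open>n\<close>.\<close>
definition half :: "nat \<Rightarrow> nat \<Rightarrow> int" where
  "half n y = int y * ((int n + 1) div 2) mod int n"

text \<open>The factor \<open>(int n + 1) div 2\<close> is the inverse of 2 modulo \<open>n\<close>;
  an odd difference becomes even after adding \<open>n\<close>.\<close>

lemma half_diff:
  assumes "odd n" "int y - int x = 2 * d \<or> int y - int x + int n = 2 * d"
  shows "(half n y - half n x) mod int n = d mod int n"
proof -
  obtain h where n: "int n = 2 * h + 1" using assms(1) by (metis even_of_nat_iff oddE)
  have "(half n y - half n x) mod int n = ((int y - int x) * (h + 1)) mod int n"
    by (simp add: half_def n mod_simps algebra_simps)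
  also have "\<exists>q. (int y - int x) * (h + 1) = d + int n * q"
    using assms(2)
  proof
    assume "int y - int x = 2 * d"
    then have "(int y - int x) * (h + 1) = d + int n * d" unfolding n by (simp add: algebra_simps)
    then show ?thesis by blast
  next
    assume "int y - int x + int n = 2 * d"
    then have *: "int y - int x = 2 * d - int n" by simp
    have "(int y - int x) * (h + 1) = d + int n * (d - h - 1)"
      unfolding * n by (simp add: algebra_simps)
    then show ?thesis by blast
  qed
  then have "((int y - int x) * (h + 1)) mod int n = d mod int n" by auto
  finally show ?thesis .
qed

text \<open>Let \<open>D = y - x\<close>. If \<open>D\<close> is even, \<open>D / 2\<close> lies
  strictly between \<open>- n / 2\<close> and \<open>n / 2\<close>, so it represents an arc exactly
  if \<open>D > 0\<close>. If \<open>D\<close> is odd, \<open>(D + n) / 2\<close> lies between 0 and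
  \<open>n\<close>, and it is at most \<open>(n - 1) / 2\<close> exactly if
  \<open>D < 0\<close>.\<close>

lemma half_arc_iff:
  assumes "odd n" "x < n" "y < n"
  shows "(half n x, half n y) \<in> parcs (RLT n) \<longleftrightarrow> arc x y"
proof -
  obtain h where n: "int n = 2 * h + 1" using assms(1) by (metis even_of_nat_iff oddE)
  have range: "half n x \<in> {0..<int n}" "half n y \<in> {0..<int n}"
    using assms(2) by (auto simp: half_def)
  define D where "D = int y - int x"
  have D: "- int n < D" "D < int n" using assms by (auto simp: D_def)
  have par: "even D \<longleftrightarrow> (even x \<longleftrightarrow> even y)" by (auto simp: D_def)
  define d where "d = (if even D then D div 2 else (D + int n) div 2)"
  have d: "if even D then D = 2 * d else D + int n = 2 * d"
    using assms(1) by (auto simp: d_def)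
  have "(half n y - half n x) mod int n = d mod int n"
    using d by (intro half_diff[OF assms(1)]) (auto simp: D_def split: if_splits)
  also have "d mod int n = (if d < 0 then d + int n else d)"
  proof (cases "d < 0")
    case True
    have "(d + int n) mod int n = d + int n"
      using True d D n by (intro mod_pos_pos_trivial) (auto split: if_splits)
    then show ?thesis using True by simp
  next
    case False
    then show ?thesis using d D n by (simp add: mod_pos_pos_trivial split: if_splits)
  qed
  finally have "(half n x, half n y) \<in> parcs (RLT n) \<longleftrightarrow> (if d < 0 then d + int n else d) \<in> {1..h}"
    using range n by (simp add: RLT_def)
  also have "\<dots> \<longleftrightarrow> (0 < D \<longleftrightarrow> even D)"
    using d D n by (auto split: if_splits)
  also have "\<dots> \<longleftrightarrow> arc x y" unfolding par arc_def by (simp add: D_def)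
  finally show ?thesis .
qed

text \<open>If two distinct labels had the same image, the arc between them would become a loop, but
  there are no loops.\<close>

lemma bij_betw_half:
  assumes "odd n"
  shows "bij_betw (half n) {..<n} {0..<int n}"
proof -
  have n: "n > 0" using assms by (rule odd_pos)
  have "inj_on (half n) {..<n}"
  proof (rule inj_onI)
    fix x y assume xy: "x \<in> {..<n}" "y \<in> {..<n}" "half n x = half n y"
    show "x = y"
    proof (rule ccontr)
      assume "x \<noteq> y"
      then have "arc x y \<or> arc y x" "\<not> arc x x" by (auto simp: arc_def)
      then show False
        using xy half_arc_iff[OF assms, of x y] half_arc_iff[OF assms, of y x]
          half_arc_iff[OF assms, of x x] by simp
    qed
  qed
  moreover have "half n ` {..<n} \<subseteq> {0..<int n}" using n by (auto simp: half_def)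
  ultimately show ?thesis
    by (simp add: bij_betw_def card_image card_subset_eq)
qed

text \<open>Each cycle has exactly one rotation that begins with its smallest label.\<close>

lemma num_cycles_RLT:
  assumes "odd n"
  shows "num_cycles (with_proj (RLT n)) (Suc k) = card (rooted_cycles n k)"
proof -
  have inj: "inj_on (half n) {..<n}" and surj: "half n ` {..<n} = {0..<int n}"
    using bij_betw_half[OF assms] by (auto simp: bij_betw_def)
  have wf: "pair_wf_digraph (RLT n)"
    using pair_digraph_RLT[of n] by (simp add: pair_digraph_def pair_fin_digraph_def)
  let ?F = "\<lambda>xs. cycle_arcs (map (half n) xs)"
  have arcs_iff: "?F (x # xs) \<subseteq> parcs (RLT n) \<longleftrightarrow> successively arc (x # xs @ [x])"
    if "set (x # xs) \<subseteq> {..<n}" for x xs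
  proof -
    have "(half n a, half n b) \<in> parcs (RLT n) \<longleftrightarrow> arc a b" if "(a, b) \<in> cycle_arcs (x # xs)" for a b
      using that cycle_arcs_subset[of "x # xs"] \<open>set (x # xs) \<subseteq> {..<n}\<close>
      by (intro half_arc_iff[OF assms]) auto
    then have "?F (x # xs) \<subseteq> parcs (RLT n) \<longleftrightarrow> cycle_arcs (x # xs) \<subseteq> {(a, b). arc a b}"
      unfolding cycle_arcs_map by fastforce
    then show ?thesis unfolding cycle_arcs_Cons_subset_iff by simp
  qed
  have "{cycle_arcs vs | vs. length vs = Suc k \<and> distinct vs \<and> cycle_arcs vs \<subseteq> parcs (RLT n)} =
    ?F ` rooted_cycles n k" (is "?L = ?R")
  proof (intro equalityI subsetI)
    fix C assume "C \<in> ?L"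
    then obtain vs where vs: "C = cycle_arcs vs" "length vs = Suc k" "distinct vs"
      "cycle_arcs vs \<subseteq> parcs (RLT n)" by auto
    have "set vs \<subseteq> half n ` {..<n}"
      using Domain_mono[OF vs(4)] unfolding surj Domain_cycle_arcs by (auto simp: RLT_def)
    then have "vs \<in> map (half n) ` lists {..<n}"
      by (simp add: lists_image[symmetric] in_lists_conv_set subset_iff)
    then obtain ws where ws: "vs = map (half n) ws" "set ws \<subseteq> {..<n}"
      by auto
    have ws': "distinct ws" "length ws = Suc k" using vs ws by (auto simp: distinct_map)
      have "Min (set ws) \<in> set ws" using ws' by (intro Min_in) auto
    then obtain i where i: "i < length ws" "ws ! i = Min (set ws)" by (auto simp: in_set_conv_nth)
    \<comment> \<open>Rotating the smallest label to the front leaves the arc set unchanged.\<close>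
    have "hd (rotate i ws) = Min (set ws)"
      using i by (subst hd_rotate_conv_nth) auto
    then obtain z ys where zys: "rotate i ws = z # ys" "z = Min (set ws)"
      using i by (cases "rotate i ws") auto
    have set: "set (z # ys) = set ws" and dist: "distinct (z # ys)" and len: "length (z # ys) = Suc k"
      using ws' by (simp_all only: zys(1)[symmetric] set_rotate distinct_rotate length_rotate)
    have C: "?F (z # ys) = C"
      unfolding zys(1)[symmetric] rotate_map[symmetric] cycle_arcs_rotate vs(1) ws(1) ..
    have "successively arc (z # ys @ [z])"
      using arcs_iff[of z ys] C vs(1,4) set ws(2) by (simp only:)
    moreover have "\<forall>y\<in>set ys. z < y"
    proof
      fix y assume "y \<in> set ys"
      then have "y \<in> set ws" "z \<noteq> y" using set dist by auto
      moreover from this have "z \<le> y" unfolding zys(2) by simp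
      ultimately show "z < y" by simp
    qed
    ultimately have "z # ys \<in> rooted_cycles n k"
      using set dist len ws(2) unfolding rooted_cycles_def by auto
    then show "C \<in> ?R" using C by blast
  next
    fix C assume "C \<in> ?R"
    then obtain z ys where zys: "C = ?F (z # ys)" "length ys = k" "distinct ys" "set (z # ys) \<subseteq> {..<n}"
      "\<forall>y\<in>set ys. z < y" "successively arc (z # ys @ [z])"
      by (auto simp: rooted_cycles_def)
    have "distinct (map (half n) (z # ys))"
      unfolding distinct_map using zys inj_on_subset[OF inj zys(4)] by auto
    moreover have "C \<subseteq> parcs (RLT n)" using arcs_iff[OF zys(4)] zys by simp
    ultimately show "C \<in> ?L" using zys(1,2)
      by (intro CollectI exI[of _ "map (half n) (z # ys)"]) simp
  qed
  moreover have "inj_on ?F (rooted_cycles n k)"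
  proof (rule inj_onI)
    fix xs ys assume xs: "xs \<in> rooted_cycles n k" and ys: "ys \<in> rooted_cycles n k" and eq: "?F xs = ?F ys"
    have sub: "set xs \<subseteq> {..<n}" "set ys \<subseteq> {..<n}" and dist: "distinct xs" "distinct ys"
      using xs ys by (auto simp: rooted_cycles_def)
    have hd: "hd us = Min (set us)" if us: "us \<in> rooted_cycles n k" for us
    proof -
      obtain z zs where "us = z # zs" "\<forall>y\<in>set zs. z < y"
        using us by (auto simp: rooted_cycles_def)
      then have "Min (set us) = z" by (intro Min_eqI) auto
      then show ?thesis by (simp add: \<open>us = z # zs\<close>)
    qed
    have "inj_on (map_prod (half n) (half n)) ({..<n} \<times> {..<n})"
      using inj by (auto simp: inj_on_def)
    moreover have "cycle_arcs xs \<subseteq> {..<n} \<times> {..<n}" "cycle_arcs ys \<subseteq> {..<n} \<times> {..<n}"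
      using cycle_arcs_subset sub by fast+
    ultimately have "cycle_arcs xs = cycle_arcs ys"
      using eq unfolding cycle_arcs_map by (metis inj_on_image_eq_iff)
    moreover from this have "hd xs = hd ys" using xs ys by (metis Domain_cycle_arcs hd)
    ultimately show "xs = ys" using dist by (intro cycle_arcs_inject)
  qed
  ultimately show ?thesis
    by (simp add: num_cycles_with_proj[OF wf] card_image)
qed

text \<open>For \<open>m < 8\<close> one of the factors vanishes, so the polynomial is valid for
  every \<open>m\<close>.\<close>

lemma real_choose_8:
  "real (m choose 8) = real m * (real m - 1) * (real m - 2) * (real m - 3) * (real m - 4) *
     (real m - 5) * (real m - 6) * (real m - 7) / 40320"
  by (simp add: binomial_gbinomial gbinomial_prod_rev eval_nat_numeral fact_numeral)

theorem theorem2: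
  fixes n :: nat
  assumes "odd n"
  shows "real (num_cycles (with_proj (RLT n)) 8) =
    (real n + 1) * real n * (real n - 1) * (real n - 3) * (real n - 5) * (real n - 7) *
      (83 * real n ^ 2 - 575 * real n + 510) / 161280"
proof -
  obtain k where n: "n = 2 * k + 1" using assms by (rule oddE)
  have "int (num_cycles (with_proj (RLT n)) 8) =
      (\<Sum>e\<le>8. pattern_sum 8 False e ham_cycles * int ((n + e) div 2 choose 8))"
    using num_cycles_RLT[OF assms, of 7] card_rooted_cycles[of n 7] by simp
  also have "{..8::nat} = {0, 1, 2, 3, 4, 5, 6, 7, 8}" by auto
  \<comment> \<open>Here \<open>(n + e) div 2 = k + (e + 1) div 2\<close>, so the pairs 1, 2 and 3,
    4 and 5, 6 and 7, 8 share a binomial: 0 + 213, 568 + 1415, 1696 + 979 and 392 + 49. The term for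
    \<open>e = 0\<close> is zero.\<close>
  also have "(\<Sum>e\<in>{0, 1, 2, 3, 4, 5, 6, 7, 8}. pattern_sum 8 False e ham_cycles * int ((n + e) div 2 choose 8)) =
      int (213 * ((k + 1) choose 8) + 1983 * ((k + 2) choose 8) + 2675 * ((k + 3) choose 8) + 441 * ((k + 4) choose 8))"
    using pattern_sum_8 by (simp add: n add.commute[of _ k])
  finally have "real (num_cycles (with_proj (RLT n)) 8) =
      213 * real ((k + 1) choose 8) + 1983 * real ((k + 2) choose 8) +
      2675 * real ((k + 3) choose 8) + 441 * real ((k + 4) choose 8)"
    by linarith
  also have "\<dots> = (real n + 1) * real n * (real n - 1) * (real n - 3) * (real n - 5) * (real n - 7) *
      (83 * real n ^ 2 - 575 * real n + 510) / 161280"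
  proof -
    define x where "x = real k"
    have x: "real n = 2 * x + 1" by (simp add: n x_def)
    show ?thesis
      unfolding real_choose_8 of_nat_add x_def[symmetric] of_nat_numeral of_nat_1 x by algebra
  qed
  finally show ?thesis .
qed

end
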